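(* Let $H$ be a complex Hilbert space, let $\Omega\subset H$ be open, and let $u\in\mathcal{PSH}(\Omega)\cap C^2(\Omega)$. Assume that for every bounded open set $G\Subset\Omega$ and every $\varepsilon>0$ there exists a proper closed subspace $E_{\varepsilon,G}\subsetneq H$ such that \[ \|P_{E_{\varepsilon,G}^\perp}D'D''u(z)\|\le\varepsilon\qquad\text{for all }z\in G . \] Then $u$ is maximal in $\Omega$.
   Context: The inner product of $H$ is linear in the first variable. $P_F$ denotes the orthogonal projection onto a closed subspace $F$, and $\|\cdot\|$ of an operator is the operator norm. Plurisubharmonic: for $\Omega\subset H$ open, $\mathcal{PSH}(\Omega)$ is the set of upper semicontinuous $u:\Omega\to[-\infty,\infty)$, not identically $-\infty$ on any component of $\Omega$, such that $u(z)\le\frac1{2\pi}\int_0^{2\pi}u(z+e^{i\theta}h)\,d\theta$ whenever $z\in\Omega$, $h\in H$ and $z+\lambda h\in\Omega$ for all $|\lambda|\le1$. Levi form: for $u\in C^2(\Omega)$ with second real Fréchet differential $D^2u(a)$, $4D'D''u(a)(s,t)=D^2u(a)(s,t)+D^2u(a)(is,it)+iD^2u(a)(s,it)-iD^2u(a)(is,t)$; this form is identified with the bounded operator $D'D''u(a)$ on $H$ given by $\langle D'D''u(a)s,t\rangle=D'D''u(a)(s,t)$ (so $D'D''\|z\|^2=I$). For $u$ plurisubharmonic this operator is positive. Maximal: $G\Subset\Omega$ means $G$ is a bounded open set with $\overline G\subset\Omega$ (no compactness of $\overline G$). $u\in\mathcal{PSH}(\Omega)$ is maximal in $\Omega$ if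 for every bounded open $G\Subset\Omega$ and every $v\in\mathcal{PSH}(G)$ with $\limsup_{z\to\xi}v(z)\le u(\xi)$ for all $\xi\in\partial G$, one has $v\le u$ on $G$. *)

theory Defs
  imports "HOL-Analysis.Analysis"
begin

section \<open>Complex Hilbert spaces\<close>

class complex_vector = real_vector +
  fixes scaleC :: "complex \<Rightarrow> 'a \<Rightarrow> 'a" (infixr \<open>*\<^sub>C\<close> 75)
  assumes scaleC_add_right: "c *\<^sub>C (x + y) = c *\<^sub>C x + c *\<^sub>C y"
    and scaleC_add_left: "(c + d) *\<^sub>C x = c *\<^sub>C x + d *\<^sub>C x"
    and scaleC_scaleC: "c *\<^sub>C (d *\<^sub>C x) = (c * d) *\<^sub>C x"
    and scaleC_one: "1 *\<^sub>C x = x"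
    and scaleR_scaleC: "r *\<^sub>R x = complex_of_real r *\<^sub>C x"

global_interpretation complex_vector:
  vector_space "scaleC :: complex \<Rightarrow> 'a \<Rightarrow> 'a::complex_vector"
  by unfold_locales
    (simp_all add: scaleC_add_right scaleC_add_left scaleC_scaleC scaleC_one)

text \<open>
  The complex inner product is linear in the first variable. Its real part is the inner
  product of the superclass \<^class>\<open>real_inner\<close>, so the inherited norm is the Hilbert norm
  (see \<open>cinner_self\<close> below) and the inherited metric and topology are the usual ones.
\<close>

class complex_inner = complex_vector + real_inner +
  fixes cinner :: "'a \<Rightarrow> 'a \<Rightarrow> complex"
  assumes cinner_commute: "cinner x y = cnj (cinner y x)"
    and cinner_add_left: "cinner (x + y) z = cinner x z + cinner y z"
    and cinner_scaleC_left: "cinner (c *\<^sub>C x) y = c * cinner x y"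
    and inner_eq_Re_cinner: "inner x y = Re (cinner x y)"

class chilbert_space = complex_inner + complete_space

lemma cinner_self: "cinner x x = complex_of_real ((norm x)\<^sup>2)"
  for x :: "'a::complex_inner"
proof (rule complex_eqI)
  show "Re (cinner x x) = Re (complex_of_real ((norm x)\<^sup>2))"
    by (simp add: inner_eq_Re_cinner[symmetric] dot_square_norm)
  have "Im (cinner x x) = Im (cnj (cinner x x))"
    using cinner_commute[of x x] by simp
  then show "Im (cinner x x) = Im (complex_of_real ((norm x)\<^sup>2))"
    by simp
qed

definition closed_csubspace :: "'a::complex_inner set \<Rightarrow> bool" where
  "closed_csubspace E \<longleftrightarrow> complex_vector.subspace E \<and> closed E"

definition corthogonal_comp :: "'a::complex_inner set \<Rightarrow> 'a set" where
  "corthogonal_comp E = {x. \<forall>y\<in>E. cinner x y = 0}"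

definition orthogonal_projection :: "'a::complex_inner set \<Rightarrow> 'a \<Rightarrow> 'a" where
  "orthogonal_projection F x = (THE y. y \<in> F \<and> x - y \<in> corthogonal_comp F)"


section \<open>Second real Frechet differential and Levi form\<close>

definition fderiv ::
    "('a::real_normed_vector \<Rightarrow> 'b::real_normed_vector) \<Rightarrow> 'a \<Rightarrow> 'a \<Rightarrow>\<^sub>L 'b" where
  "fderiv f a = Blinfun (frechet_derivative f (at a))"

definition C2_on :: "'a::real_normed_vector set \<Rightarrow> ('a \<Rightarrow> real) \<Rightarrow> bool" where
  "C2_on \<Omega> u \<longleftrightarrow>
     (\<forall>a\<in>\<Omega>. u differentiable (at a)) \<and>
     (\<forall>a\<in>\<Omega>. fderiv u differentiable (at a)) \<and>
     continuous_on \<Omega> (fderiv (fderiv u))"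

definition D2 :: "('a::real_normed_vector \<Rightarrow> real) \<Rightarrow> 'a \<Rightarrow> 'a \<Rightarrow> 'a \<Rightarrow> real" where
  "D2 u a s t = blinfun_apply (blinfun_apply (fderiv (fderiv u) a) s) t"

definition levi_form :: "('a::complex_inner \<Rightarrow> real) \<Rightarrow> 'a \<Rightarrow> 'a \<Rightarrow> 'a \<Rightarrow> complex" where
  "levi_form u a s t =
     (complex_of_real (D2 u a s t) + complex_of_real (D2 u a (\<i> *\<^sub>C s) (\<i> *\<^sub>C t))
      + \<i> * complex_of_real (D2 u a s (\<i> *\<^sub>C t))
      - \<i> * complex_of_real (D2 u a (\<i> *\<^sub>C s) t)) / 4"

text \<open>
  The type \<open>'a \<Rightarrow>\<^sub>L 'a\<close> consists of the real-linear bounded operators; complex linearity of the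
  operator below follows from that of the Levi form in \<open>s\<close>.
\<close>

definition levi_operator :: "('a::complex_inner \<Rightarrow> real) \<Rightarrow> 'a \<Rightarrow> 'a \<Rightarrow>\<^sub>L 'a" where
  "levi_operator u a = (THE T. \<forall>s t. cinner (blinfun_apply T s) t = levi_form u a s t)"


section \<open>Plurisubharmonic and maximal functions\<close>

definition usc_on :: "'a::topological_space set \<Rightarrow> ('a \<Rightarrow> ereal) \<Rightarrow> bool" where
  "usc_on \<Omega> u \<longleftrightarrow> (\<forall>z\<in>\<Omega>. \<forall>c. u z < c \<longrightarrow> (\<forall>\<^sub>F w in at z within \<Omega>. u w < c))"

text \<open>
  The integral is the difference of the integrals of the positive and the negative part
  (\<^const>\<open>e2ennreal\<close> truncates negative values to 0). For an upper semicontinuous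
  integrand with values in \<open>[-\<infinity>, \<infinity>)\<close> the first of these is finite, so
  the difference is well defined, with values in \<open>[-\<infinity>, \<infinity>)\<close>.
\<close>

definition circle_mean :: "('a::complex_inner \<Rightarrow> ereal) \<Rightarrow> 'a \<Rightarrow> 'a \<Rightarrow> ereal" where
  "circle_mean u z h =
     (enn2ereal (\<integral>\<^sup>+\<theta>\<in>{0..2 * pi}. e2ennreal (u (z + cis \<theta> *\<^sub>C h)) \<partial>lborel)
      - enn2ereal (\<integral>\<^sup>+\<theta>\<in>{0..2 * pi}. e2ennreal (- u (z + cis \<theta> *\<^sub>C h)) \<partial>lborel))
     / ereal (2 * pi)"

text \<open>Only the values of \<open>u\<close> on \<open>\<Omega>\<close> matter; \<open>\<Omega>\<close> is meant to be open.\<close>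

definition psh_on :: "'a::complex_inner set \<Rightarrow> ('a \<Rightarrow> ereal) \<Rightarrow> bool" where
  "psh_on \<Omega> u \<longleftrightarrow>
     (\<forall>z\<in>\<Omega>. u z < \<infinity>) \<and>
     usc_on \<Omega> u \<and>
     (\<forall>C\<in>components \<Omega>. \<exists>z\<in>C. u z \<noteq> -\<infinity>) \<and>
     (\<forall>z h. z \<in> \<Omega> \<and> (\<forall>c. norm c \<le> 1 \<longrightarrow> z + c *\<^sub>C h \<in> \<Omega>) \<longrightarrow> u z \<le> circle_mean u z h)"

definition well_inside :: "'a::metric_space set \<Rightarrow> 'a set \<Rightarrow> bool" (infix \<open>\<Subset>\<close> 50) where
  "G \<Subset> \<Omega> \<longleftrightarrow> open G \<and> bounded G \<and> closure G \<subseteq> \<Omega>"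

definition maximal_psh_on :: "'a::complex_inner set \<Rightarrow> ('a \<Rightarrow> ereal) \<Rightarrow> bool" where
  "maximal_psh_on \<Omega> u \<longleftrightarrow>
     psh_on \<Omega> u \<and>
     (\<forall>G v. G \<Subset> \<Omega> \<and> psh_on G v \<and>
        (\<forall>\<xi>\<in>frontier G. Limsup (at \<xi> within G) v \<le> u \<xi>) \<longrightarrow>
        (\<forall>z\<in>G. v z \<le> u z))"

end

theory Submission
  imports Defs
begin

text \<open>
  The hypothesis makes \<open>u\<close> almost harmonic along some complex direction, and a single complex
  direction is enough to run the classical maximum principle.

  Let \<open>G \<Subset> \<Omega>\<close>, let \<open>v\<close> be plurisubharmonic on \<open>G\<close> with boundary values at most \<open>u\<close>, and let
  \<open>\<epsilon> > 0\<close>. The subspace \<open>E\<close> belonging to \<open>G\<close> and \<open>\<epsilon>\<close> is proper and closed, so there is a unit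
  vector \<open>e\<close> orthogonal to it. The projection onto the orthogonal complement of \<open>E\<close> does not change
  inner products with \<open>e\<close>; hence \<open>\<langle>D'D''u(z)e, e\<rangle> \<le> \<epsilon>\<close> on \<open>G\<close>, which says that the Laplacian of
  \<open>\<lambda> \<mapsto> u(z + \<lambda>e)\<close> at \<open>0\<close> is at most \<open>4\<epsilon>\<close> (\<open>laplacian_le_of_projected_levi_operator\<close>).

  Fix \<open>a \<in> G\<close> and consider the slice \<open>D = {\<lambda>. a + \<lambda>e \<in> G}\<close>, a bounded open set in the complex
  plane. Whereas \<open>closure G\<close> need not be compact, \<open>closure D\<close> is. On \<open>D\<close> the function
  \<open>w(\<lambda>) = v(a + \<lambda>e) - u(a + \<lambda>e) + 2\<epsilon>\<bar>\<lambda>\<bar>\<^sup>2\<close> satisfies a strict sub-mean value inequality on small circles around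
  each point where it is finite, because the Laplacian \<open>8\<epsilon>\<close> of the last term outweighs the \<open>4\<epsilon>\<close> lost
  through \<open>u\<close>; so it has no interior maximum, and it is bounded by
  its boundary values, which are at most \<open>2\<epsilon>R\<^sup>2\<close> when \<open>G\<close> lies within distance \<open>R\<close> of \<open>a\<close>. At \<open>\<lambda> = 0\<close>
  this reads \<open>v(a) \<le> u(a) + 2\<epsilon>R\<^sup>2\<close> (\<open>slice_comparison\<close>). The vector \<open>e\<close> depends on \<open>\<epsilon>\<close>, but \<open>R\<close> does
  not, so \<open>\<epsilon> \<rightarrow> 0\<close> gives \<open>v(a) \<le> u(a)\<close>.

  An interior maximum is excluded by comparing second-order terms at that one point: the sub-mean
  value inequality for \<open>v\<close> on a small circle contradicts the Taylor expansion of \<open>u\<close> averaged over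
  the circle (\<open>circle_mean_less_of_laplacian_le\<close>).

  The projection and the Levi operator are definite descriptions. That they denote what they should
  rests on the projection theorem in a complete inner product space and on Riesz representation.
\<close>

section \<open>Complex inner products\<close>

lemma cinner_scaleC_right: "cinner x (c *\<^sub>C y) = cnj c * cinner x y"
  for x :: "'a::complex_inner"
  by (metis cinner_commute cinner_scaleC_left complex_cnj_cnj complex_cnj_mult)

lemma norm_scaleC: "norm (c *\<^sub>C x) = norm c * norm x"
  for x :: "'a::complex_inner"
proof -
  have "complex_of_real ((norm (c *\<^sub>C x))\<^sup>2) = c * cnj c * complex_of_real ((norm x)\<^sup>2)"
    by (simp add: cinner_self[symmetric] cinner_scaleC_left cinner_scaleC_right del: of_real_power)
  also have "\<dots> = complex_of_real ((norm c * norm x)\<^sup>2)"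
    by (simp only: complex_norm_square[symmetric] of_real_mult[symmetric] power_mult_distrib)
  finally have "(norm (c *\<^sub>C x))\<^sup>2 = (norm c * norm x)\<^sup>2"
    by (simp only: of_real_eq_iff)
  then show ?thesis
    by (simp add: power2_eq_iff_nonneg)
qed

lemma Im_cinner: "Im (cinner x y) = inner x (\<i> *\<^sub>C y)"
  for x :: "'a::complex_inner"
  by (simp add: inner_eq_Re_cinner cinner_scaleC_right)

text \<open>
  A vector that represents the real part of a conjugate-linear functional in the real inner product
  represents the functional itself in the complex one: the imaginary part is the real part at
  \<open>\<i> *\<^sub>C t\<close>. This lets the real theory of orthogonality carry the complex one.
\<close>

lemma cinner_eqI:
  fixes x y :: "'a::complex_inner"
  assumes "\<And>t. inner x t = Re (f t)" and "\<And>t. f (\<i> *\<^sub>C t) = - \<i> * f t"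
  shows "cinner x t = f t"
proof (rule complex_eqI)
  show "Re (cinner x t) = Re (f t)"
    by (simp add: assms(1) inner_eq_Re_cinner[symmetric])
  show "Im (cinner x t) = Im (f t)"
    by (simp add: assms Im_cinner)
qed

lemma cinner_diff_left: "cinner (x - y) z = cinner x z - cinner y z"
  for x :: "'a::complex_inner"
  using cinner_add_left[of "x - y" y z] by simp

lemma cinner_zero_left: "cinner 0 z = 0"
  for z :: "'a::complex_inner"
  using cinner_add_left[of 0 0 z] by simp

lemma bounded_linear_scaleC: "bounded_linear (\<lambda>x :: 'a::complex_inner. c *\<^sub>C x)"
proof (rule bounded_linear_intro[where K = "norm c"])
  fix r and x :: 'a
  show "c *\<^sub>C r *\<^sub>R x = r *\<^sub>R c *\<^sub>C x"
    by (simp add: scaleR_scaleC scaleC_scaleC mult.commute)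
qed (simp_all add: scaleC_add_right norm_scaleC mult.commute)

lemma bounded_linear_scaleC_left: "bounded_linear (\<lambda>c. c *\<^sub>C (x :: 'a::complex_inner))"
proof (rule bounded_linear_intro[where K = "norm x"])
  fix r and c :: complex
  show "(r *\<^sub>R c) *\<^sub>C x = r *\<^sub>R c *\<^sub>C x"
    by (simp add: scaleR_scaleC scaleC_scaleC scaleR_conv_of_real)
qed (simp_all add: scaleC_add_left norm_scaleC)

section \<open>Orthogonal projection and Riesz representation\<close>

text \<open>
  By the parallelogram law a sequence in \<open>M\<close> whose distances to \<open>x\<close> tend to the infimum is Cauchy:
  the midpoint of two of its terms lies in \<open>M\<close> too, so it cannot be closer than the infimum.
\<close>

lemma closed_subspace_closest_point:
  fixes M :: "'a::{real_inner, complete_space} set"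
  assumes "subspace M" and "closed M"
  obtains y where "y \<in> M" and "\<And>m. m \<in> M \<Longrightarrow> norm (x - y) \<le> norm (x - m)"
proof -
  have ne: "M \<noteq> {}" using assms(1) subspace_0 by auto
  define d where "d = infdist x M"
  have d0: "d \<ge> 0" by (simp add: d_def infdist_nonneg)
  have d_le: "d \<le> norm (x - m)" if "m \<in> M" for m
    using infdist_le[OF that, of x] by (simp add: d_def dist_norm)
  have "\<exists>y\<in>M. norm (x - y) < d + 1 / (real n + 1)" for n
  proof -
    have "(INF m\<in>M. dist x m) < d + 1 / (real n + 1)"
      using ne by (simp add: d_def infdist_def)
    then show ?thesis
      using cINF_less_iff[OF ne, of "dist x"] 
      by (metis bdd_belowI2 dist_norm zero_le_dist)
  qed
  then obtain y where yM: "\<And>n. y n \<in> M" and y: "\<And>n. norm (x - y n) < d + 1 / (real n + 1)"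
    by metis
  have gap: "(norm (y m - y n))\<^sup>2 \<le> (8 * d + 4) / (real N + 1)" if "m \<ge> N" "n \<ge> N" for m n N
  proof -
    define q where "q = 1 / (real N + 1)"
    have q: "0 < q" "q \<le> 1" by (auto simp: q_def)
    have *: "(norm (x - y k))\<^sup>2 \<le> d\<^sup>2 + (2 * d + 1) * q" if "k \<ge> N" for k
    proof -
      have "1 / (real k + 1) \<le> q" using that by (simp add: q_def frac_le)
      then have "norm (x - y k) \<le> d + q" using y[of k] by linarith
      then have "(norm (x - y k))\<^sup>2 \<le> (d + q)\<^sup>2" by (intro power_mono) auto
      also have "\<dots> \<le> d\<^sup>2 + (2 * d + 1) * q"
        using mult_left_mono[of q 1 q] q by (simp add: power2_eq_square algebra_simps)
      finally show ?thesis .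
    qed
    have mid: "(1/2) *\<^sub>R (y m + y n) \<in> M"
      using assms(1) yM by (simp add: subspace_add subspace_scale)
    have "d\<^sup>2 \<le> (norm (x - (1/2) *\<^sub>R (y m + y n)))\<^sup>2"
      using d_le[OF mid] d0 by (intro power_mono) auto
    moreover have "(norm (y m - y n))\<^sup>2 = 2 * (norm (x - y m))\<^sup>2 + 2 * (norm (x - y n))\<^sup>2
        - 4 * (norm (x - (1/2) *\<^sub>R (y m + y n)))\<^sup>2"
      by (simp add: power2_norm_eq_inner inner_diff_left inner_diff_right inner_add_left
          inner_add_right inner_commute algebra_simps)
    ultimately have "(norm (y m - y n))\<^sup>2 \<le> 4 * ((2 * d + 1) * q)"
      using *[OF that(1)] *[OF that(2)] by linarith
    then show ?thesis by (simp add: q_def)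
  qed
  have "Cauchy y"
  proof (rule CauchyI)
    fix e :: real assume e: "0 < e"
    obtain N where N: "(8 * d + 4) / e\<^sup>2 < real N" using reals_Archimedean2 by blast
    have "(8 * d + 4) / (real N + 1) < e\<^sup>2"
      using N e d0 by (simp add: field_simps) (smt (verit) mult_nonneg_nonneg zero_le_power2)
    then have "norm (y m - y n) < e" if "m \<ge> N" "n \<ge> N" for m n
      using gap[OF that] e by (meson le_less_trans less_le power2_less_imp_less)
    then show "\<exists>M. \<forall>m\<ge>M. \<forall>n\<ge>M. norm (y m - y n) < e" by blast
  qed
  then obtain l where l: "y \<longlonglongrightarrow> l" using Cauchy_convergent convergent_def by blast
  have "l \<in> M" using closed_sequentially[OF assms(2)] yM l by blast
  moreover have "norm (x - l) \<le> norm (x - m)" if "m \<in> M" for m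
  proof -
    have "(\<lambda>n. d + 1 / (real n + 1)) \<longlonglongrightarrow> d + 0"
      by (intro tendsto_intros) (use LIMSEQ_inverse_real_of_nat in \<open>simp add: inverse_eq_divide add.commute\<close>)
    moreover have "(\<lambda>n. norm (x - y n)) \<longlonglongrightarrow> norm (x - l)" by (intro tendsto_intros l)
    ultimately have "norm (x - l) \<le> d + 0"
      using LIMSEQ_le[of "\<lambda>n. norm (x - y n)"] y less_imp_le by blast
    then show ?thesis using d_le[OF that] by simp
  qed
  ultimately show thesis using that by blast
qed

text \<open>
  The closest point \<open>y\<close> works: moving it by the component of \<open>x - y\<close> along \<open>m\<close> would otherwise
  decrease the distance.
\<close>

lemma closed_subspace_orthogonal_decomposition:
  fixes M :: "'a::{real_inner, complete_space} set"
  assumes "subspace M" and "closed M"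
  obtains y where "y \<in> M" and "\<And>m. m \<in> M \<Longrightarrow> inner (x - y) m = 0"
proof -
  obtain y where y: "y \<in> M" "\<And>m. m \<in> M \<Longrightarrow> norm (x - y) \<le> norm (x - m)"
    using closed_subspace_closest_point[OF assms] by metis
  have "inner (x - y) m = 0" if m: "m \<in> M" for m
  proof (cases "m = 0")
    case False
    define i where "i = inner (x - y) m"
    \<comment> \<open>the minimiser of the norm of \<open>(x - y) - t *\<^sub>R m\<close>\<close>
    define t where "t = i / (norm m)\<^sup>2"
    have "norm (x - y) \<le> norm (x - (y + t *\<^sub>R m))"
      using y m assms(1) by (simp add: subspace_add subspace_scale)
    then have "(norm (x - y))\<^sup>2 \<le> (norm ((x - y) - t *\<^sub>R m))\<^sup>2"
      by (simp add: power_mono diff_diff_eq)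
    also have "\<dots> = (norm (x - y))\<^sup>2 - 2 * t * i + t\<^sup>2 * (norm m)\<^sup>2"
    proof -
      have "(norm (q - t *\<^sub>R m))\<^sup>2 = (norm q)\<^sup>2 - 2 * t * inner q m + t\<^sup>2 * (norm m)\<^sup>2" for q
        unfolding power2_norm_eq_inner
        by (simp add: inner_diff_left inner_diff_right inner_commute power2_eq_square algebra_simps)
      then show ?thesis by (simp add: i_def)
    qed
    finally have "2 * t * i \<le> t\<^sup>2 * (norm m)\<^sup>2" by simp
    then have "2 * i\<^sup>2 / (norm m)\<^sup>2 \<le> i\<^sup>2 / (norm m)\<^sup>2"
      using False by (simp add: t_def power2_eq_square)
    then have "i\<^sup>2 \<le> 0" using False by (simp add: field_simps)
    then show ?thesis by (simp add: i_def)
  qed simp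
  then show thesis using that y by blast
qed

text \<open>
  The kernel of a nonzero \<open>f\<close> is a closed hyperplane, and a vector orthogonal to it represents \<open>f\<close> up to a
  scalar factor.
\<close>

lemma riesz_representation:
  fixes f :: "'a::{real_inner, complete_space} \<Rightarrow> real"
  assumes "bounded_linear f"
  shows "\<exists>w. \<forall>x. inner w x = f x"
proof (cases "\<forall>x. f x = 0")
  case True
  then show ?thesis by (intro exI[of _ 0]) simp
next
  case False
  interpret f: bounded_linear f by fact
  from False obtain x0 where x0: "f x0 \<noteq> 0" by blast
  have "subspace {x. f x = 0}" by (simp add: subspace_def f.add f.scaleR f.zero)
  moreover have "closed {x. f x = 0}"
    by (intro closed_Collect_eq f.continuous_on continuous_intros)
  ultimately obtain y where y: "f y = 0" "\<And>m. f m = 0 \<Longrightarrow> inner (x0 - y) m = 0"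
    using closed_subspace_orthogonal_decomposition[of "{x. f x = 0}" x0] by auto
  define n where "n = x0 - y"
  have fn: "f n \<noteq> 0" using x0 y by (simp add: n_def f.diff)
  then have n: "n \<noteq> 0" using f.zero by auto
  have "inner ((f n / inner n n) *\<^sub>R n) x = f x" for x
  proof -
    have "f (x - (f x / f n) *\<^sub>R n) = 0" using fn by (simp add: f.diff f.scaleR)
    then have "inner n (x - (f x / f n) *\<^sub>R n) = 0" using y by (simp add: n_def)
    then have "inner n x = f x / f n * inner n n" by (simp add: inner_diff_right)
    then show ?thesis using fn n by simp
  qed
  then show ?thesis by blast
qed

lemma bounded_bilinear_operator:
  fixes B :: "'a::{real_inner, complete_space} \<Rightarrow> 'a \<Rightarrow> real"
  assumes "bounded_bilinear B"
  obtains T :: "'a \<Rightarrow>\<^sub>L 'a" where "\<And>s t. inner (T s) t = B s t"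
proof -
  interpret B: bounded_bilinear B by fact
  obtain g where g: "\<And>s t. inner (g s) t = B s t"
    using riesz_representation[OF B.bounded_linear_right] by metis
  obtain K where K: "\<And>s t. \<bar>B s t\<bar> \<le> norm s * norm t * K" "K \<ge> 0"
    using B.nonneg_bounded by auto
  have "bounded_linear g"
  proof (rule bounded_linear_intro[where K = K])
    show "g (x + y) = g x + g y" for x y
      by (subst vector_eq_rdot[symmetric]) (simp add: g inner_add_left B.add_left)
    show "g (r *\<^sub>R x) = r *\<^sub>R g x" for r x
      by (subst vector_eq_rdot[symmetric]) (simp add: g inner_add_left B.scaleR_left)
    show "norm (g s) \<le> norm s * K" for s
    proof (cases "g s = 0")
      case False
      have "norm (g s) * norm (g s) \<le> norm s * K * norm (g s)"
        using K(1)[of s "g s"] g[of s "g s"] by (simp add: dot_square_norm power2_eq_square mult_ac)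
      then show ?thesis using False by simp
    qed (simp add: K)
  qed
  then have "inner (Blinfun g s) t = B s t" for s t
    by (simp add: g bounded_linear_Blinfun_apply)
  then show thesis using that by blast
qed


section \<open>The Levi operator\<close>

lemma levi_form_scaleC_i: "levi_form u a s (\<i> *\<^sub>C t) = - \<i> * levi_form u a s t"
proof -
  have [simp]: "\<i> *\<^sub>C \<i> *\<^sub>C t = - t"
    by (metis complex_vector.scale_minus_left i_squared scaleC_one scaleC_scaleC)
  have [simp]: "D2 u a x (- y) = - D2 u a x y" for x y
    by (simp add: D2_def blinfun.minus_right)
  show ?thesis
    by (simp add: levi_form_def field_simps)
qed

text \<open>
  The real part of the Levi form is a bounded real bilinear form, so it is represented by a bounded
  operator; since the form is conjugate-linear in its second argument, that operator also represents
  the imaginary part.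
\<close>

lemma cinner_levi_operator:
  fixes u :: "'a::chilbert_space \<Rightarrow> real"
  shows "cinner (levi_operator u a s) t = levi_form u a s t"
proof -
  define B where "B s t = Re (levi_form u a s t)" for s t
  have B_eq: "B s t = (D2 u a s t + D2 u a (\<i> *\<^sub>C s) (\<i> *\<^sub>C t)) / 4" for s t
    by (simp add: B_def levi_form_def)
  interpret D: bounded_bilinear "D2 u a"
    unfolding D2_def
    by (rule bounded_bilinear.comp1[OF bounded_bilinear_blinfun_apply]) (rule blinfun.bounded_linear_right)
  interpret J: bounded_linear "\<lambda>x :: 'a. \<i> *\<^sub>C x"
    by (rule bounded_linear_scaleC)
  obtain K where K: "\<And>s t. norm (D2 u a s t) \<le> norm s * norm t * K"
    using D.bounded by blast
  have "bounded_bilinear B"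
  proof
    show "\<exists>K. \<forall>s t. norm (B s t) \<le> norm s * norm t * K"
    proof (intro exI allI)
      show "norm (B s t) \<le> norm s * norm t * (K / 2)" for s t
        using K[of s t] K[of "\<i> *\<^sub>C s" "\<i> *\<^sub>C t"] by (simp add: B_eq norm_scaleC)
    qed
  qed (simp_all only: B_eq J.add J.scaleR D.add_left D.add_right D.scaleR_left D.scaleR_right,
      simp_all add: field_simps)
  then obtain T :: "'a \<Rightarrow>\<^sub>L 'a" where T: "\<And>s t. inner (T s) t = B s t"
    using bounded_bilinear_operator by blast
  have "\<forall>s t. cinner (levi_operator u a s) t = levi_form u a s t"
    unfolding levi_operator_def
  proof (rule theI[of _ T])
    show T_levi: "\<forall>s t. cinner (T s) t = levi_form u a s t"
      by (intro allI cinner_eqI) (simp_all add: T B_def levi_form_scaleC_i)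
    fix S :: "'a \<Rightarrow>\<^sub>L 'a" assume S: "\<forall>s t. cinner (S s) t = levi_form u a s t"
    have "inner (S s) t = inner (T s) t" for s t
      using S T_levi by (simp add: inner_eq_Re_cinner)
    then show "S = T"
      by (metis blinfun_eqI vector_eq_rdot)
  qed
  then show ?thesis by blast
qed

text \<open>
  On the diagonal the Levi form is a quarter of the Laplacian of \<open>u\<close> along the complex line
  spanned by \<open>s\<close>.
\<close>

lemma Re_levi_form_diag:
  "4 * Re (levi_form u a s s) = D2 u a s s + D2 u a (\<i> *\<^sub>C s) (\<i> *\<^sub>C s)"
  by (simp add: levi_form_def)

section \<open>Projection onto a closed complex subspace\<close>

lemma closed_csubspace_corthogonal_comp: "closed_csubspace (corthogonal_comp E)"
  for E :: "'a::complex_inner set"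
proof -
  have eq: "corthogonal_comp E = (\<Inter>y\<in>E. {x. inner x y = 0 \<and> inner x (\<i> *\<^sub>C y) = 0})"
    by (auto simp: corthogonal_comp_def complex_eq_iff Im_cinner inner_eq_Re_cinner[symmetric])
  have "closed {x. inner x y = 0 \<and> inner x (\<i> *\<^sub>C y) = 0}" for y :: 'a
    by (intro closed_Collect_conj closed_Collect_eq continuous_intros)
  then have "closed (corthogonal_comp E)"
    unfolding eq by blast
  moreover have "complex_vector.subspace (corthogonal_comp E)"
    by (auto simp: complex_vector.subspace_def corthogonal_comp_def cinner_add_left
        cinner_scaleC_left cinner_zero_left)
  ultimately show ?thesis by (simp add: closed_csubspace_def)
qed

lemma closed_csubspace_decomposition:
  fixes F :: "'a::chilbert_space set"
  assumes "closed_csubspace F"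
  obtains y where "y \<in> F" and "x - y \<in> corthogonal_comp F"
proof -
  have sub: "complex_vector.subspace F" and "closed F"
    using assms by (auto simp: closed_csubspace_def)
  then have "subspace F"
    by (auto simp: subspace_def complex_vector.subspace_def scaleR_scaleC)
  then obtain y where y: "y \<in> F" "\<And>m. m \<in> F \<Longrightarrow> inner (x - y) m = 0"
    using closed_subspace_orthogonal_decomposition \<open>closed F\<close> by blast
  have "cinner (x - y) m = 0" if "m \<in> F" for m
    using y(2)[OF that] y(2)[of "\<i> *\<^sub>C m"] complex_vector.subspace_scale[OF sub that]
    by (simp add: complex_eq_iff Im_cinner inner_eq_Re_cinner[symmetric])
  then show thesis using that y by (simp add: corthogonal_comp_def)
qed

lemma orthogonal_projection:
  fixes F :: "'a::chilbert_space set"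
  assumes "closed_csubspace F"
  shows "orthogonal_projection F x \<in> F"
    and "x - orthogonal_projection F x \<in> corthogonal_comp F"
proof -
  obtain y where y: "y \<in> F" "x - y \<in> corthogonal_comp F"
    using closed_csubspace_decomposition[OF assms] by metis
  have "y' = y" if "y' \<in> F" "x - y' \<in> corthogonal_comp F" for y'
  proof -
    have sub: "complex_vector.subspace F"
      using assms by (auto simp: closed_csubspace_def)
    have mem: "y' - y \<in> F"
      using sub that y by (simp add: complex_vector.subspace_diff)
    then have "cinner ((x - y) - (x - y')) (y' - y) = 0"
      using that(2) y(2) unfolding cinner_diff_left[of "x - y"] by (simp add: corthogonal_comp_def)
    then have "cinner (y' - y) (y' - y) = 0"
      by simp
    then show ?thesis
      by (simp add: cinner_self)
  qed
  then have "\<exists>!y. y \<in> F \<and> x - y \<in> corthogonal_comp F"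
    using y by blast
  from theI'[OF this]
  show "orthogonal_projection F x \<in> F" "x - orthogonal_projection F x \<in> corthogonal_comp F"
    by (simp_all add: orthogonal_projection_def)
qed

lemma norm_orthogonal_projection_le:
  fixes F :: "'a::chilbert_space set"
  assumes "closed_csubspace F"
  shows "norm (orthogonal_projection F x) \<le> norm x"
proof -
  define p where "p = orthogonal_projection F x"
  have "inner (x - p) p = 0"
    using orthogonal_projection[OF assms, of x]
    by (simp add: p_def corthogonal_comp_def inner_eq_Re_cinner)
  then have "norm p * norm p = inner x p"
    by (simp add: inner_diff_left dot_square_norm power2_eq_square)
  also have "\<dots> \<le> norm x * norm p"
    by (rule norm_cauchy_schwarz)
  finally show ?thesis
    by (cases "p = 0") (simp_all add: p_def)
qed

lemma unit_vector_in_corthogonal_comp: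
  fixes E :: "'a::chilbert_space set"
  assumes "closed_csubspace E" and "E \<noteq> UNIV"
  obtains e where "e \<in> corthogonal_comp E" and "norm e = 1"
proof -
  obtain x where x: "x \<notin> E" using assms(2) by blast
  obtain y where y: "y \<in> E" "x - y \<in> corthogonal_comp E"
    using closed_csubspace_decomposition[OF assms(1)] by metis
  have ne: "x - y \<noteq> 0" using x y by auto
  have "of_real (1 / norm (x - y)) *\<^sub>C (x - y) \<in> corthogonal_comp E"
    using closed_csubspace_corthogonal_comp[of E] y(2)
    by (simp add: closed_csubspace_def complex_vector.subspace_scale del: of_real_divide)
  moreover have "norm (of_real (1 / norm (x - y)) *\<^sub>C (x - y)) = 1"
    using ne by (simp add: norm_scaleC norm_divide)
  ultimately show thesis using that by blast
qed

text \<open>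
  The operator norm is a supremum of reals, hence meaningless for unbounded quotients; the bound by
  \<open>K\<close> rules these out.
\<close>

lemma norm_le_of_onorm_le:
  assumes "onorm f \<le> c" and "\<And>x. norm (f x) \<le> K * norm x" and "norm x = 1"
  shows "norm (f x) \<le> c"
proof -
  have K: "0 \<le> K"
    using order_trans[OF norm_ge_zero assms(2)[of x]] assms(3) by simp
  have "norm (f y) / norm y \<le> K" for y
    by (cases "y = 0") (use assms(2)[of y] K in \<open>auto simp: divide_le_eq\<close>)
  then have "bdd_above (range (\<lambda>x. norm (f x) / norm x))"
    by (intro bdd_aboveI2)
  then have "norm (f x) / norm x \<le> onorm f"
    unfolding onorm_def by (intro cSUP_upper) auto
  then show ?thesis using assms by simp
qed

text \<open>
  For \<open>e \<in> F\<close> the projection onto \<open>F\<close> can be inserted into \<open>\<langle>D'D''u(a)e, e\<rangle>\<close> without changing it, so a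
  bound on the projected operator controls the Laplacian in the direction \<open>e\<close>.
\<close>

lemma laplacian_le_of_projected_levi_operator:
  fixes u :: "'a::chilbert_space \<Rightarrow> real"
  assumes "closed_csubspace F" and "e \<in> F" and e: "norm e = 1"
    and onorm: "onorm (\<lambda>s. orthogonal_projection F (levi_operator u a s)) \<le> \<epsilon>"
  shows "D2 u a e e + D2 u a (\<i> *\<^sub>C e) (\<i> *\<^sub>C e) \<le> 4 * \<epsilon>"
proof -
  define q where "q = orthogonal_projection F (levi_operator u a e)"
  have "norm q \<le> \<epsilon>"
    unfolding q_def
  proof (rule norm_le_of_onorm_le[OF onorm _ e])
    show "norm (orthogonal_projection F (levi_operator u a x)) \<le> norm (levi_operator u a) * norm x" for x
      using norm_orthogonal_projection_le[OF assms(1)] norm_blinfun order_trans by blast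
  qed
  have "cinner (levi_operator u a e - q) e = 0"
    using orthogonal_projection(2)[OF assms(1), of "levi_operator u a e"] assms(2)
    by (simp add: corthogonal_comp_def q_def)
  then have "levi_form u a e e = cinner q e"
    by (simp add: cinner_diff_left cinner_levi_operator)
  then have "D2 u a e e + D2 u a (\<i> *\<^sub>C e) (\<i> *\<^sub>C e) = 4 * inner q e"
    by (simp add: Re_levi_form_diag[symmetric] inner_eq_Re_cinner)
  moreover have "inner q e \<le> norm q * norm e"
    by (rule norm_cauchy_schwarz)
  ultimately show ?thesis
    using \<open>norm q \<le> \<epsilon>\<close> e by simp
qed

section \<open>Second-order Taylor expansion\<close>

lemma has_derivative_fderiv:
  assumes "f differentiable (at x)"
  shows "(f has_derivative blinfun_apply (fderiv f x)) (at x)"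
proof -
  have "(f has_derivative frechet_derivative f (at x)) (at x)"
    using assms by (simp add: frechet_derivative_works)
  then show ?thesis
    unfolding fderiv_def
    by (simp add: bounded_linear_Blinfun_apply has_derivative_bounded_linear)
qed

text \<open>
  The expansion is obtained from the mean value theorem on the segment from \<open>a\<close> to \<open>a + h\<close>. There
  the first differential is compared with its own linearisation at \<open>a\<close>, which is what second
  differentiability at the single point \<open>a\<close> provides.
\<close>

lemma second_order_taylor:
  fixes u :: "'a::real_normed_vector \<Rightarrow> real"
  assumes "open \<Omega>" "a \<in> \<Omega>" and du: "\<And>x. x \<in> \<Omega> \<Longrightarrow> u differentiable (at x)"
    and "fderiv u differentiable (at a)" and "\<eta> > 0"
  obtains \<delta> where "\<delta> > 0"
    and "\<And>h. norm h < \<delta> \<Longrightarrow> \<bar>u (a + h) - u a - fderiv u a h - D2 u a h h / 2\<bar> \<le> \<eta> * (norm h)\<^sup>2"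
proof -
  obtain d1 where d1: "d1 > 0" "ball a d1 \<subseteq> \<Omega>"
    using assms(1,2) open_contains_ball by blast
  obtain d2 where d2: "d2 > 0" "\<And>y. norm (y - a) < d2 \<Longrightarrow>
      norm (fderiv u y - fderiv u a - fderiv (fderiv u) a (y - a)) \<le> \<eta> * norm (y - a)"
    using has_derivative_fderiv[OF assms(4)] \<open>\<eta> > 0\<close> unfolding has_derivative_at_alt by blast
  define \<delta> where "\<delta> = min d1 d2"
  have in_Omega: "a + h \<in> \<Omega>" if "norm h < \<delta>" for h
    using that d1(2) by (auto simp: \<delta>_def dist_norm subset_eq)
  have "\<bar>u (a + h) - u a - fderiv u a h - D2 u a h h / 2\<bar> \<le> \<eta> * (norm h)\<^sup>2" if h: "norm h < \<delta>" for h
  proof -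
    \<comment> \<open>the remainder along the segment; its derivative compares \<open>fderiv u\<close> with its linearisation\<close>
    define \<psi> where "\<psi> t = u (a + t *\<^sub>R h) - t * fderiv u a h - t\<^sup>2 / 2 * D2 u a h h" for t
    define \<psi>' where "\<psi>' t = fderiv u (a + t *\<^sub>R h) h - fderiv u a h - t * D2 u a h h" for t
    have small: "norm (t *\<^sub>R h) < \<delta>" if "0 \<le> t" "t \<le> 1" for t
      using that h mult_left_le_one_le[of "norm h" t] by simp
    have "(\<psi> has_real_derivative \<psi>' t) (at t)" if t: "0 \<le> t" "t \<le> 1" for t
    proof -
      have "((\<lambda>t. u (a + t *\<^sub>R h)) has_derivative (\<lambda>x. fderiv u (a + t *\<^sub>R h) (x *\<^sub>R h))) (at t)"
        by (rule has_derivative_compose[of "\<lambda>t. a + t *\<^sub>R h" "\<lambda>x. x *\<^sub>R h" _ _ u])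
          (use in_Omega[OF small[OF t]] in \<open>auto intro!: derivative_eq_intros has_derivative_fderiv du\<close>)
      then have "((\<lambda>t. u (a + t *\<^sub>R h)) has_real_derivative fderiv u (a + t *\<^sub>R h) h) (at t)"
        by (simp add: has_field_derivative_def blinfun.scaleR_right mult.commute[of _ "blinfun_apply _ _"] fun_eq_iff)
      then show ?thesis
        unfolding \<psi>_def \<psi>'_def by (auto intro!: derivative_eq_intros)
    qed
    then obtain z where z: "0 < z" "z < 1" "\<psi> 1 - \<psi> 0 = (1 - 0) * \<psi>' z"
      using MVT2[of 0 1 \<psi> \<psi>'] by auto
    let ?L = "fderiv u (a + z *\<^sub>R h) - fderiv u a - fderiv (fderiv u) a (z *\<^sub>R h)"
    have "norm ?L \<le> \<eta> * norm (z *\<^sub>R h)"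
      using d2(2)[of "a + z *\<^sub>R h"] small[of z] z by (simp add: \<delta>_def)
    also have "\<dots> \<le> \<eta> * norm h"
      using z \<open>\<eta> > 0\<close> by (simp add: mult_left_le_one_le)
    finally have L: "norm ?L \<le> \<eta> * norm h" .
    have "\<psi>' z = ?L h"
      by (simp add: \<psi>'_def D2_def blinfun.diff_left blinfun.scaleR_right blinfun.scaleR_left)
    then have "\<bar>\<psi>' z\<bar> \<le> norm ?L * norm h"
      using norm_blinfun[of ?L h] by simp
    also have "\<dots> \<le> \<eta> * norm h * norm h"
      using L by (rule mult_right_mono) simp
    finally show ?thesis
      using z by (simp add: \<psi>_def power2_eq_square algebra_simps)
  qed
  then show thesis
    using that[of \<delta>] d1 d2 by (simp add: \<delta>_def)
qed

section \<open>Circle means\<close>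

text \<open>
  The positive part of \<open>v\<close> lies below that of \<open>f\<close> and the negative part above that of \<open>f\<close>; both parts
  of \<open>f\<close> have finite integrals, so their difference is the ordinary integral of \<open>f\<close>.
\<close>

lemma circle_mean_le:
  assumes bound: "\<And>\<theta>. v (z + cis \<theta> *\<^sub>C h) \<le> ereal (f \<theta>)"
    and int: "has_bochner_integral lborel (\<lambda>\<theta>. f \<theta> * indicator {0..2 * pi} \<theta>) I"
  shows "circle_mean v z h \<le> ereal (I / (2 * pi))"
proof -
  let ?c = "\<lambda>\<theta>. f \<theta> * indicator {0..2 * pi} \<theta>"
  let ?P = "\<integral>\<^sup>+\<theta>\<in>{0..2 * pi}. e2ennreal (v (z + cis \<theta> *\<^sub>C h)) \<partial>lborel"
  let ?N = "\<integral>\<^sup>+\<theta>\<in>{0..2 * pi}. e2ennreal (- v (z + cis \<theta> *\<^sub>C h)) \<partial>lborel"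
  have ir: "integrable lborel ?c" and I: "I = integral\<^sup>L lborel ?c"
    using int by (auto simp: has_bochner_integral_iff)
  have fin: "(\<integral>\<^sup>+\<theta>. ennreal (?c \<theta>) \<partial>lborel) < \<infinity>" "(\<integral>\<^sup>+\<theta>. ennreal (- ?c \<theta>) \<partial>lborel) < \<infinity>"
    using ir real_integrable_def[of lborel ?c] by (auto simp: top.not_eq_extremum)
  have P: "?P \<le> (\<integral>\<^sup>+\<theta>. ennreal (?c \<theta>) \<partial>lborel)"
  proof (rule nn_integral_mono)
    fix \<theta>
    show "e2ennreal (v (z + cis \<theta> *\<^sub>C h)) * indicator {0..2 * pi} \<theta> \<le> ennreal (?c \<theta>)"
      using e2ennreal_mono[OF bound[of \<theta>]] by (auto simp: indicator_def e2ennreal_ereal)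
  qed
  have N: "(\<integral>\<^sup>+\<theta>. ennreal (- ?c \<theta>) \<partial>lborel) \<le> ?N"
  proof (rule nn_integral_mono)
    fix \<theta>
    have "ereal (- f \<theta>) \<le> - v (z + cis \<theta> *\<^sub>C h)"
      using bound[of \<theta>] by (metis ereal_minus_le_minus uminus_ereal.simps(1))
    then show "ennreal (- ?c \<theta>) \<le> e2ennreal (- v (z + cis \<theta> *\<^sub>C h)) * indicator {0..2 * pi} \<theta>"
      using e2ennreal_mono[of "ereal (- f \<theta>)"] by (auto simp: indicator_def e2ennreal_ereal)
  qed
  have "enn2ereal ?P - enn2ereal ?N
      \<le> enn2ereal (\<integral>\<^sup>+\<theta>. ennreal (?c \<theta>) \<partial>lborel) - enn2ereal (\<integral>\<^sup>+\<theta>. ennreal (- ?c \<theta>) \<partial>lborel)"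
    using P N by (intro ereal_minus_mono) (simp_all add: less_eq_ennreal.rep_eq)
  also have "\<dots> = ereal I"
    using fin unfolding I real_lebesgue_integral_def[OF ir]
    by (cases "\<integral>\<^sup>+\<theta>. ennreal (?c \<theta>) \<partial>lborel"; cases "\<integral>\<^sup>+\<theta>. ennreal (- ?c \<theta>) \<partial>lborel")
      (auto simp: enn2ereal_ennreal)
  finally have "circle_mean v z h \<le> ereal I / ereal (2 * pi)"
    unfolding circle_mean_def by (intro ereal_divide_right_mono) auto
  then show ?thesis by simp
qed

text \<open>The restriction to a circle of a polynomial of degree two in the real coordinates.\<close>

lemma has_bochner_integral_trig:
  "has_bochner_integral lborel
    (\<lambda>\<theta>. (A + B * cos \<theta> + C * sin \<theta> + D * (cos \<theta>)\<^sup>2 + E * (sin \<theta> * cos \<theta>) + G * (sin \<theta>)\<^sup>2)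
      * indicator {0..2 * pi} \<theta>)
    (2 * pi * (A + (D + G) / 2))"
proof -
  define F where "F \<theta> = A * \<theta> + B * sin \<theta> - C * cos \<theta> + D * (\<theta> + sin \<theta> * cos \<theta>) / 2
    + E * (sin \<theta>)\<^sup>2 / 2 + G * (\<theta> - sin \<theta> * cos \<theta>) / 2" for \<theta> :: real
  have "(F has_real_derivative
      A + B * cos x + C * sin x + D * (cos x)\<^sup>2 + E * (sin x * cos x) + G * (sin x)\<^sup>2) (at x)" for x
    unfolding F_def
    apply (auto intro!: derivative_eq_intros)
    using sin_cos_squared_add[of x]
    by algebra
  then have "has_bochner_integral lborel
    (\<lambda>\<theta>. (A + B * cos \<theta> + C * sin \<theta> + D * (cos \<theta>)\<^sup>2 + E * (sin \<theta> * cos \<theta>) + G * (sin \<theta>)\<^sup>2)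
      * indicator {0..2 * pi} \<theta>) (F (2 * pi) - F 0)"
    by (intro has_bochner_integral_FTC_Icc_real) auto
  moreover have "F (2 * pi) - F 0 = 2 * pi * (A + (D + G) / 2)"
    by (simp add: F_def field_simps)
  ultimately show ?thesis by simp
qed

text \<open>
  Averaged over a circle of radius \<open>r\<close>, the Taylor polynomial of \<open>u\<close> contributes \<open>r\<^sup>2/4\<close> times the
  Laplacian, at most \<open>\<epsilon>r\<^sup>2\<close>, its remainder at most \<open>\<epsilon>r\<^sup>2/2\<close>, and the quadratic penalty \<open>-2\<epsilon>r\<^sup>2\<close>; all
  first-order terms cancel. A function \<open>v\<close> below this majorant on the circle therefore has mean
  strictly below \<open>s\<close>. The point \<open>p\<close> is the coordinate of \<open>z\<close> on the slice, where the penalty is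
  centred at another point of the slice.
\<close>

lemma circle_mean_less_of_laplacian_le:
  fixes u :: "'a::complex_inner \<Rightarrow> real"
  assumes "open \<Omega>" "z \<in> \<Omega>" "\<And>x. x \<in> \<Omega> \<Longrightarrow> u differentiable (at x)"
    and "fderiv u differentiable (at z)" and e: "norm e = 1"
    and lap: "D2 u z e e + D2 u z (\<i> *\<^sub>C e) (\<i> *\<^sub>C e) \<le> 4 * \<epsilon>" and "\<epsilon> > 0"
  obtains \<delta> where "\<delta> > 0"
    and "\<And>r v. 0 < r \<Longrightarrow> r < \<delta> \<Longrightarrow>
      (\<And>\<theta>. v (z + cis \<theta> *\<^sub>C of_real r *\<^sub>C e) \<le> ereal (s + u (z + cis \<theta> *\<^sub>C of_real r *\<^sub>C e) - u z
          - 2 * \<epsilon> * ((norm (p + cis \<theta> * of_real r))\<^sup>2 - (norm p)\<^sup>2))) \<Longrightarrow>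
      circle_mean v z (of_real r *\<^sub>C e) < ereal s"
proof -
  obtain \<delta> where \<delta>: "\<delta> > 0" "\<And>h. norm h < \<delta> \<Longrightarrow>
      \<bar>u (z + h) - u z - fderiv u z h - D2 u z h h / 2\<bar> \<le> \<epsilon> / 2 * (norm h)\<^sup>2"
    using second_order_taylor[OF assms(1-4), of "\<epsilon> / 2"] \<open>\<epsilon> > 0\<close> by (metis half_gt_zero)
  let ?ie = "\<i> *\<^sub>C e"
  have mean: "circle_mean v z (of_real r *\<^sub>C e) < ereal s"
    if r: "0 < r" "r < \<delta>"
      and v: "\<And>\<theta>. v (z + cis \<theta> *\<^sub>C of_real r *\<^sub>C e) \<le> ereal (s + u (z + cis \<theta> *\<^sub>C of_real r *\<^sub>C e) - u z
          - 2 * \<epsilon> * ((norm (p + cis \<theta> * of_real r))\<^sup>2 - (norm p)\<^sup>2))" for r v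
  proof -
    \<comment> \<open>coefficients of the trigonometric majorant: in \<open>A\<close>, the penalty \<open>-2\<epsilon>r\<^sup>2\<close> and the Taylor
      remainder \<open>\<epsilon>r\<^sup>2/2\<close> add up to \<open>-3\<epsilon>r\<^sup>2/2\<close>\<close>
    define A where "A = s - 3 / 2 * \<epsilon> * r\<^sup>2"
    define B where "B = r * fderiv u z e - 4 * \<epsilon> * r * Re p"
    define C where "C = r * fderiv u z ?ie - 4 * \<epsilon> * r * Im p"
    define D where "D = r\<^sup>2 / 2 * D2 u z e e"
    define E where "E = r\<^sup>2 / 2 * (D2 u z e ?ie + D2 u z ?ie e)"
    define G where "G = r\<^sup>2 / 2 * D2 u z ?ie ?ie"
    have bound: "v (z + cis \<theta> *\<^sub>C of_real r *\<^sub>C e) \<le> ereal (A + B * cos \<theta> + C * sin \<theta>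
        + D * (cos \<theta>)\<^sup>2 + E * (sin \<theta> * cos \<theta>) + G * (sin \<theta>)\<^sup>2)" for \<theta>
    proof -
      define h where "h = cis \<theta> *\<^sub>C of_real r *\<^sub>C e"
      have norm_h: "norm h = r" using r e by (simp add: h_def norm_scaleC norm_mult)
      have "cis \<theta> * of_real r = of_real (r * cos \<theta>) + of_real (r * sin \<theta>) * \<i>"
        by (simp add: complex_eq_iff)
      then have h: "h = (r * cos \<theta>) *\<^sub>R e + (r * sin \<theta>) *\<^sub>R ?ie"
        by (simp only: h_def scaleC_scaleC scaleC_add_left scaleR_scaleC)
      have lin: "fderiv u z h = r * cos \<theta> * fderiv u z e + r * sin \<theta> * fderiv u z ?ie"
        by (simp add: h blinfun.add_right blinfun.scaleR_right)
      have quad: "D2 u z h h / 2 = D * (cos \<theta>)\<^sup>2 + E * (sin \<theta> * cos \<theta>) + G * (sin \<theta>)\<^sup>2"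
        by (simp add: h D2_def D_def E_def G_def blinfun.add_right blinfun.scaleR_right
            blinfun.add_left blinfun.scaleR_left power2_eq_square algebra_simps)
      have "r\<^sup>2 * (cos \<theta>)\<^sup>2 + r\<^sup>2 * (sin \<theta>)\<^sup>2 = r\<^sup>2"
        by (simp flip: distrib_left)
      then have sq: "(norm (p + cis \<theta> * of_real r))\<^sup>2 - (norm p)\<^sup>2
          = 2 * r * (Re p * cos \<theta> + Im p * sin \<theta>) + r\<^sup>2"
        unfolding cmod_power2
        by (simp add: power2_sum power_mult_distrib distrib_left algebra_simps)
      have "u (z + h) - u z - fderiv u z h - D2 u z h h / 2 \<le> \<epsilon> / 2 * r\<^sup>2"
        using abs_le_D1[OF \<delta>(2)[of h]] r norm_h by simp
      then have "s + u (z + h) - u z - 2 * \<epsilon> * ((norm (p + cis \<theta> * of_real r))\<^sup>2 - (norm p)\<^sup>2)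
          \<le> A + B * cos \<theta> + C * sin \<theta> + D * (cos \<theta>)\<^sup>2 + E * (sin \<theta> * cos \<theta>) + G * (sin \<theta>)\<^sup>2"
        unfolding lin quad sq by (simp add: A_def B_def C_def algebra_simps)
      then show ?thesis
        using v[of \<theta>] unfolding h_def by (meson ereal_less_eq(3) order_trans)
    qed
    have "circle_mean v z (of_real r *\<^sub>C e) \<le> ereal (2 * pi * (A + (D + G) / 2) / (2 * pi))"
      by (rule circle_mean_le[OF bound has_bochner_integral_trig])
    moreover have "2 * pi * (A + (D + G) / 2) / (2 * pi) < s"
    proof -
      have "D + G \<le> r\<^sup>2 / 2 * (4 * \<epsilon>)"
        unfolding D_def G_def distrib_left[symmetric] by (intro mult_left_mono lap) simp
      moreover have "0 < \<epsilon> * r\<^sup>2" using \<open>\<epsilon> > 0\<close> r by simp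
      ultimately show ?thesis by (simp add: A_def)
    qed
    ultimately show ?thesis by (meson ereal_less(2) less_ereal.simps(1) order_le_less_trans)
  qed
  then show thesis using that \<delta>(1) by blast
qed

section \<open>Maximum principle on slices\<close>

text \<open>
  The maximum of an upper semicontinuous function on a relatively compact set that is not closed:
  it suffices that near each missing point \<open>p\<close> the function stays below one of its values. If no
  maximum existed, every point of \<open>K\<close> would have a neighbourhood on which \<open>w\<close> stays below a fixed
  value \<open>w q\<close>; among the finitely many such values given by a subcover, the largest one would be
  exceeded by another.
\<close>

lemma attains_max_relative_to_compact:
  fixes w :: "'b::topological_space \<Rightarrow> 'c::linorder"
  assumes "compact K" "D \<subseteq> K" "D \<noteq> {}"
    and usc: "\<And>p q. p \<in> D \<Longrightarrow> q \<in> D \<Longrightarrow> w p < w q \<Longrightarrow> \<forall>\<^sub>F x in at p within D. w x < w q"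
    and bd: "\<And>p. p \<in> K - D \<Longrightarrow> \<exists>q\<in>D. \<forall>\<^sub>F x in at p within D. w x < w q"
  shows "\<exists>m\<in>D. \<forall>x\<in>D. w x \<le> w m"
proof (rule ccontr)
  assume "\<not> ?thesis"
  then have no_max: "\<exists>q\<in>D. w p < w q" if "p \<in> D" for p
    using that by (meson not_le)
  have "\<exists>q U. q \<in> D \<and> open U \<and> p \<in> U \<and> (\<forall>x\<in>U \<inter> D. w x < w q)" if p: "p \<in> K" for p
  proof -
    obtain q where q: "q \<in> D" "\<forall>\<^sub>F x in at p within D. w x < w q" "p \<in> D \<Longrightarrow> w p < w q"
      using no_max[of p] usc[of p] bd[of p] p by (cases "p \<in> D") auto
    from q(2) obtain U where "open U" "p \<in> U" "\<forall>x\<in>U. x \<noteq> p \<longrightarrow> x \<in> D \<longrightarrow> w x < w q"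
      unfolding eventually_at_topological by auto
    then show ?thesis using q by (metis IntE)
  qed
  then obtain q U where qU: "\<And>p. p \<in> K \<Longrightarrow> q p \<in> D \<and> open (U p) \<and> p \<in> U p \<and> (\<forall>x\<in>U p \<inter> D. w x < w (q p))"
    by metis
  obtain P where P: "P \<subseteq> K" "finite P" "K \<subseteq> (\<Union>p\<in>P. U p)"
    using compactE_image[OF \<open>compact K\<close>, of K U] qU by blast
  have "P \<noteq> {}" using P assms(2,3) by auto
  then obtain p where p: "p \<in> P" "\<And>p'. p' \<in> P \<Longrightarrow> w (q p') \<le> w (q p)"
    using P(2) obtains_MAX[of P "\<lambda>p. w (q p)"] by (metis Max_ge finite_imageI image_eqI)
  have qp: "q p \<in> D" using p(1) P(1) qU by blast
  then obtain p' where "p' \<in> P" "q p \<in> U p'" using P(3) assms(2) by blast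
  then have "w (q p) < w (q p')" using qU[of p'] P(1) qp by blast
  then show False using p(2)[OF \<open>p' \<in> P\<close>] by simp
qed

text \<open>
  Upper semicontinuity of a sum with a continuous real function. The first hypothesis says
  \<open>limsup f \<le> L\<close>; it is this form that both the semicontinuity of \<open>v\<close> inside \<open>G\<close> and its boundary
  condition provide.
\<close>

lemma eventually_add_real_less:
  fixes f :: "'b \<Rightarrow> ereal" and c :: "'b \<Rightarrow> real"
  assumes f: "\<And>t. L < ereal t \<Longrightarrow> \<forall>\<^sub>F x in F. f x < ereal t"
    and c: "(c \<longlongrightarrow> c0) F" and less: "L + ereal c0 < B"
  shows "\<forall>\<^sub>F x in F. f x + ereal (c x) < B"
proof -
  obtain t where t: "L + ereal c0 < ereal t" "ereal t < B"
    using ereal_dense2[OF less] by blast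
  then have "L < ereal (t - c0)"
    by (cases L) auto
  then obtain t' where t': "L < ereal t'" "t' < t - c0"
    using ereal_dense2 by (metis less_ereal.simps(1))
  have "\<forall>\<^sub>F x in F. c x < t - t'"
    using t'(2) by (intro order_tendstoD(2)[OF c]) simp
  with f[OF t'(1)] show ?thesis
  proof eventually_elim
    case (elim x)
    then have "f x + ereal (c x) < ereal t"
      by (cases "f x") auto
    then show ?case using t(2) by simp
  qed
qed

text \<open>
  The maximum principle for \<open>w(\<lambda>) = v(a + \<lambda>e) - u(a + \<lambda>e) + 2\<epsilon>\<bar>\<lambda>\<bar>\<^sup>2\<close> on a slice of \<open>G\<close>. If the
  conclusion failed, \<open>w(0)\<close> would exceed all boundary values, so \<open>w\<close> would attain a maximum at an
  interior point \<open>p\<close> of the slice. The maximality bounds \<open>v\<close> on circles around \<open>p\<close> by the majorant of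
  \<open>circle_mean_less_of_laplacian_le\<close>, contradicting the sub-mean value inequality. On the slice
  \<open>v\<close> may well take the value \<open>-\<infinity>\<close>, but not at the maximum.
\<close>

lemma slice_comparison:
  fixes u :: "'a::complex_inner \<Rightarrow> real"
  assumes "open \<Omega>" "C2_on \<Omega> u" "G \<Subset> \<Omega>" "psh_on G v"
    and boundary: "\<And>\<xi>. \<xi> \<in> frontier G \<Longrightarrow> Limsup (at \<xi> within G) v \<le> ereal (u \<xi>)"
    and e: "norm e = 1" and "\<epsilon> > 0"
    and lap: "\<And>z. z \<in> G \<Longrightarrow> D2 u z e e + D2 u z (\<i> *\<^sub>C e) (\<i> *\<^sub>C e) \<le> 4 * \<epsilon>"
    and a: "a \<in> G" and R: "\<And>z. z \<in> G \<Longrightarrow> dist a z \<le> R"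
  shows "v a \<le> ereal (u a + 2 * \<epsilon> * R\<^sup>2)"
proof (rule ccontr)
  assume "\<not> ?thesis"
  then have big: "ereal (u a + 2 * \<epsilon> * R\<^sup>2) < v a" by simp
  have G: "open G" "bounded G" "closure G \<subseteq> \<Omega>"
    using \<open>G \<Subset> \<Omega>\<close> by (auto simp: well_inside_def)
  have du: "\<And>x. x \<in> \<Omega> \<Longrightarrow> u differentiable (at x)"
    and ddu: "\<And>x. x \<in> \<Omega> \<Longrightarrow> fderiv u differentiable (at x)"
    using \<open>C2_on \<Omega> u\<close> by (auto simp: C2_on_def)
  have v_fin: "\<And>z. z \<in> G \<Longrightarrow> v z < \<infinity>" and v_usc: "usc_on G v"
    and v_mean: "\<And>z h. z \<in> G \<Longrightarrow> (\<And>c. norm c \<le> 1 \<Longrightarrow> z + c *\<^sub>C h \<in> G) \<Longrightarrow> v z \<le> circle_mean v z h"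
    using \<open>psh_on G v\<close> by (auto simp: psh_on_def)
  define L where "L l = a + l *\<^sub>C e" for l :: complex
  define D where "D = L -` G"
  define c where "c l = 2 * \<epsilon> * (norm l)\<^sup>2 - u (L l)" for l
  define w where "w l = v (L l) + ereal (c l)" for l
  interpret S: bounded_linear "\<lambda>l. l *\<^sub>C e" by (rule bounded_linear_scaleC_left)
  have dist_L: "dist (L l) (L l') = dist l l'" for l l'
    using S.diff[of l l'] e by (simp add: L_def dist_norm norm_scaleC flip: complex_vector.scale_left_diff_distrib)
  have cont_L: "continuous_on UNIV L"
    unfolding L_def by (intro continuous_intros S.continuous_on)
  have L0: "L 0 = a" by (simp add: L_def)
  have "0 \<in> D" using a by (simp add: D_def L0)
  have norm_D: "norm l \<le> R" if "l \<in> D" for l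
    using R[of "L l"] that dist_L[of 0 l] by (simp add: D_def L0)
  then have "bounded D" by (meson boundedI)
  have L_closure: "L p \<in> closure G" if "p \<in> closure D" for p
    using image_closure_subset[of D L "closure G"] that cont_L closure_subset
    by (metis (no_types, lifting) D_def closed_closure continuous_on_subset image_subset_iff
        subset_UNIV subset_trans vimage_eq)
  have norm_closure: "norm p \<le> R" if "p \<in> closure D" for p
    using norm_D that closure_minimal[of D "cball 0 R"] by (auto simp: subset_eq)
  have filter_L: "filterlim L (at (L p) within G) (at p within D)" for p
  proof -
    have "(L \<longlongrightarrow> L p) (at p within D)"
      using cont_L by (metis continuous_on continuous_on_subset iso_tuple_UNIV_I subset_UNIV tendsto_within_subset)
    moreover have "\<forall>\<^sub>F l in at p within D. L l \<in> G \<and> L l \<noteq> L p"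
      unfolding eventually_at_filter using dist_L by (intro always_eventually) (metis D_def dist_eq_0_iff vimage_eq)
    ultimately show ?thesis by (auto simp: filterlim_at elim: eventually_mono)
  qed
  have c_lim: "(c \<longlongrightarrow> c p) (at p within D)" if "p \<in> closure D" for p
  proof -
    have "isCont u (L p)"
      using du L_closure[OF that] G(3) differentiable_imp_continuous_within by blast
    moreover have "(L \<longlongrightarrow> L p) (at p within D)"
      using filter_L by (simp add: filterlim_at)
    ultimately have "((\<lambda>l. u (L l)) \<longlongrightarrow> u (L p)) (at p within D)"
      using isCont_tendsto_compose by blast
    then show ?thesis
      unfolding c_def by (intro tendsto_intros)
  qed
  have "\<exists>p\<in>D. \<forall>x\<in>D. w x \<le> w p"
  proof (rule attains_max_relative_to_compact)
    show "compact (closure D)" using \<open>bounded D\<close> by (simp add: compact_closure)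
    show "D \<subseteq> closure D" by (rule closure_subset)
    show "D \<noteq> {}" using \<open>0 \<in> D\<close> by blast
  next
    fix p q assume p: "p \<in> D" and "q \<in> D" and less: "w p < w q"
    show "\<forall>\<^sub>F x in at p within D. w x < w q"
      unfolding w_def
    proof (rule eventually_add_real_less)
      show "(c \<longlongrightarrow> c p) (at p within D)" using c_lim p closure_subset by blast
      show "v (L p) + ereal (c p) < v (L q) + ereal (c q)" using less by (simp add: w_def)
      fix t assume "v (L p) < ereal t"
      then have "\<forall>\<^sub>F z in at (L p) within G. v z < ereal t"
        using v_usc p by (auto simp: usc_on_def D_def)
      then show "\<forall>\<^sub>F x in at p within D. v (L x) < ereal t"
        using filter_L by (rule eventually_compose_filterlim)
    qed
  next
    fix p assume p: "p \<in> closure D - D"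
    have "\<forall>\<^sub>F x in at p within D. w x < w 0"
      unfolding w_def
    proof (rule eventually_add_real_less)
      show "(c \<longlongrightarrow> c p) (at p within D)" using c_lim p by blast
      have "(norm p)\<^sup>2 \<le> R\<^sup>2" using norm_closure p by (intro power_mono) auto
      then have "ereal (u (L p)) + ereal (c p) \<le> ereal (2 * \<epsilon> * R\<^sup>2)"
        using \<open>\<epsilon> > 0\<close> by (simp add: c_def)
      also have "\<dots> < v (L 0) + ereal (c 0)"
        using big by (cases "v a") (auto simp: L0 c_def)
      finally show "ereal (u (L p)) + ereal (c p) < v (L 0) + ereal (c 0)" .
      have "L p \<in> frontier G"
        using p L_closure[of p] G(1) by (auto simp: frontier_def interior_open D_def)
      then have lim: "Limsup (at (L p) within G) v \<le> ereal (u (L p))" by (rule boundary)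
      fix t assume "ereal (u (L p)) < ereal t"
      then have "\<forall>\<^sub>F z in at (L p) within G. v z < ereal t"
        using lim by (intro Limsup_lessD) (rule order_le_less_trans)
      then show "\<forall>\<^sub>F x in at p within D. v (L x) < ereal t"
        using filter_L by (rule eventually_compose_filterlim)
    qed
    then show "\<exists>q\<in>D. \<forall>\<^sub>F x in at p within D. w x < w q" using \<open>0 \<in> D\<close> by blast
  qed
  then obtain p where p: "p \<in> D" and max: "\<And>x. x \<in> D \<Longrightarrow> w x \<le> w p" by blast
  define z where "z = L p"
  have z: "z \<in> G" using p by (simp add: z_def D_def)
  then have z': "z \<in> \<Omega>" using G(3) closure_subset by blast
  have "v z \<noteq> -\<infinity>"
    using max[OF \<open>0 \<in> D\<close>] big by (cases "v a") (auto simp: w_def z_def L0)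
  then obtain s where s: "v z = ereal s"
    using v_fin[OF z] by (cases "v z") auto
  obtain \<delta> where \<delta>: "\<delta> > 0" and mean: "\<And>r v. 0 < r \<Longrightarrow> r < \<delta> \<Longrightarrow>
      (\<And>\<theta>. v (z + cis \<theta> *\<^sub>C of_real r *\<^sub>C e) \<le> ereal (s + u (z + cis \<theta> *\<^sub>C of_real r *\<^sub>C e) - u z
          - 2 * \<epsilon> * ((norm (p + cis \<theta> * of_real r))\<^sup>2 - (norm p)\<^sup>2))) \<Longrightarrow>
      circle_mean v z (of_real r *\<^sub>C e) < ereal s"
    using circle_mean_less_of_laplacian_le[OF \<open>open \<Omega>\<close> z' du ddu[OF z'] e lap[OF z] \<open>\<epsilon> > 0\<close>] by metis
  obtain \<rho> where \<rho>: "\<rho> > 0" "ball z \<rho> \<subseteq> G"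
    using G(1) z open_contains_ball by blast
  define r where "r = min \<delta> \<rho> / 2"
  have r: "0 < r" "r < \<delta>" "r < \<rho>" using \<delta> \<rho>(1) by (auto simp: r_def)
  have disc: "z + k *\<^sub>C of_real r *\<^sub>C e \<in> G" if "norm k \<le> 1" for k
  proof -
    have "norm k * r \<le> r" using that r by (simp add: mult_left_le_one_le)
    then have "norm k * r < \<rho>" using r by linarith
    then have "dist z (z + k *\<^sub>C of_real r *\<^sub>C e) < \<rho>"
      using r e by (simp add: dist_norm norm_scaleC norm_mult)
    then show ?thesis using \<rho>(2) by (auto simp: subset_eq)
  qed
  have "circle_mean v z (of_real r *\<^sub>C e) < ereal s"
  proof (rule mean[OF r(1,2)])
    fix \<theta>
    define x where "x = p + cis \<theta> * of_real r"
    have Lx: "L x = z + cis \<theta> *\<^sub>C of_real r *\<^sub>C e"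
      by (simp add: x_def L_def z_def scaleC_add_left scaleC_scaleC add.assoc)
    have "x \<in> D" using disc[of "cis \<theta>"] by (simp add: D_def Lx)
    then have "v (L x) + ereal (c x) \<le> ereal (s + c p)"
      using max s by (simp add: w_def flip: z_def)
    then have "v (L x) \<le> ereal (s + c p - c x)"
      by (cases "v (L x)") auto
    then show "v (z + cis \<theta> *\<^sub>C of_real r *\<^sub>C e) \<le> ereal (s + u (z + cis \<theta> *\<^sub>C of_real r *\<^sub>C e) - u z
        - 2 * \<epsilon> * ((norm (p + cis \<theta> * of_real r))\<^sup>2 - (norm p)\<^sup>2))"
      unfolding Lx[symmetric] x_def[symmetric] by (simp add: c_def algebra_simps flip: z_def)
  qed
  moreover have "v z \<le> circle_mean v z (of_real r *\<^sub>C e)"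
    using v_mean[OF z] disc by blast
  ultimately show False using s by simp
qed

theorem proposition4p8:
  fixes \<Omega> :: "'a::chilbert_space set" and u :: "'a \<Rightarrow> real"
  assumes "open \<Omega>"
    and "psh_on \<Omega> (\<lambda>z. ereal (u z))"
    and "C2_on \<Omega> u"
    and "\<And>G \<epsilon>. G \<Subset> \<Omega> \<Longrightarrow> \<epsilon> > 0 \<Longrightarrow>
           \<exists>E. closed_csubspace E \<and> E \<noteq> UNIV \<and>
             (\<forall>z\<in>G. onorm (\<lambda>s. orthogonal_projection (corthogonal_comp E)
                              (blinfun_apply (levi_operator u z) s)) \<le> \<epsilon>)"
  shows "maximal_psh_on \<Omega> (\<lambda>z. ereal (u z))"
  unfolding maximal_psh_on_def
proof (intro conjI allI impI ballI)
  show "psh_on \<Omega> (\<lambda>z. ereal (u z))" by fact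
  fix G v a
  assume hyp: "G \<Subset> \<Omega> \<and> psh_on G v \<and>
    (\<forall>\<xi>\<in>frontier G. Limsup (at \<xi> within G) v \<le> ereal (u \<xi>))" and a: "a \<in> G"
  then have G: "G \<Subset> \<Omega>" by blast
  then have "bounded G" by (simp add: well_inside_def)
  then obtain R where R: "\<And>z. z \<in> G \<Longrightarrow> dist a z \<le> R"
    by (metis bounded_any_center)
  have est: "v a \<le> ereal (u a + 2 * \<epsilon> * R\<^sup>2)" if "\<epsilon> > 0" for \<epsilon>
  proof -
    obtain E where E: "closed_csubspace E" "E \<noteq> UNIV"
      and on: "\<And>z. z \<in> G \<Longrightarrow> onorm (\<lambda>s. orthogonal_projection (corthogonal_comp E) (levi_operator u z s)) \<le> \<epsilon>"
      using assms(4)[OF G \<open>\<epsilon> > 0\<close>] by blast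
    obtain e where e: "e \<in> corthogonal_comp E" "norm e = 1"
      using unit_vector_in_corthogonal_comp[OF E] by blast
    show ?thesis
    proof (rule slice_comparison[OF assms(1,3) G _ _ e(2) \<open>\<epsilon> > 0\<close> _ a R])
      show "D2 u z e e + D2 u z (\<i> *\<^sub>C e) (\<i> *\<^sub>C e) \<le> 4 * \<epsilon>" if "z \<in> G" for z
        using laplacian_le_of_projected_levi_operator[OF closed_csubspace_corthogonal_comp e on[OF that]] .
    qed (use hyp in auto)
  qed
  show "v a \<le> ereal (u a)"
  proof (rule ereal_le_epsilon2)
    fix \<eta> :: real assume "\<eta> > 0"
    \<comment> \<open>the summand \<open>1\<close> only avoids a division by zero\<close>
    define \<epsilon> where "\<epsilon> = \<eta> / (2 * (R\<^sup>2 + 1))"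
    have pos: "0 < R\<^sup>2 + 1" by (simp add: add_nonneg_pos)
    then have "\<epsilon> > 0" using \<open>\<eta> > 0\<close> by (simp add: \<epsilon>_def)
    then have "v a \<le> ereal (u a + 2 * \<epsilon> * R\<^sup>2)" by (rule est)
    also have "\<dots> \<le> ereal (u a + 2 * \<epsilon> * (R\<^sup>2 + 1))"
      using \<open>\<epsilon> > 0\<close> by simp
    also have "2 * \<epsilon> * (R\<^sup>2 + 1) = \<eta>"
      using pos by (simp only: \<epsilon>_def) (simp add: field_simps)
    also have "ereal (u a + \<eta>) = ereal (u a) + ereal \<eta>"
      by simp
    finally show "v a \<le> ereal (u a) + ereal \<eta>" .
  qed
qed

end
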